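(* Let $\epsilon>0$ and consider the following local exchange algorithm. Start with an inventory-agnostic policy that offers a deterministic sequence of assortments, and let $\overline R>0$ denote the total expected revenue of this initial policy. Given the current policy $\mu$, for each $j\in\mathcal J$ and $t\in\mathcal T$ let $S^*_{jt}\in\arg\max_{S\subseteq\mathcal N}\mathrm{rev}(M_{jt}(\mu,S))$, and check whether the total expected revenue of $M_{jt}(\mu,S^*_{jt})$ improves that of $\mu$ by a factor of at least $1+\epsilon\,\frac{4}{mT}$, that is, whether $\mathrm{rev}(M_{jt}(\mu,S^*_{jt}))\ge(1+\epsilon\,\frac{4}{mT})\,\mathrm{rev}(\mu)$. If this holds for some $j\in\mathcal J$ and $t\in\mathcal T$, then redefine $\mu$ as $M_{jt}(\mu,S^*_{jt})$ for such a pair $(j,t)$ and start over; otherwise stop. The total expected revenue improves by a factor of at least $1+\epsilon\,\frac{4}{mT}$ at each update, the total expected revenue of any policy is at most $\sum_{i\in\mathcal N}r_i\,c_i$, and the algorithm stops in $$O\!\left(\frac{mT}{\epsilon}\,\log\!\Big(\frac{\sum_{i\in\mathcal N}r_i\,c_i}{\overline R}\Big)\right)$$ updates. The policy $\mu$ at which it stops satisfies $\mathrm{rev}(\mu)\ge(\frac12-\epsilon)\,\mathrm{opt}^{\mathrm{det}}$.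
   Context: Model. Products $\mathcal N=\{1,\dots,n\}$; product $i$ has revenue $r_i\ge 0$ and initial inventory $c_i\in\mathbb Z_+$. Customer types $\mathcal J=\{1,\dots,m\}$; time periods $\mathcal T=\{1,\dots,T\}$. At each period $t$ exactly one customer arrives, of type $j$ with probability $\lambda_{jt}\ge0$, $\sum_{j\in\mathcal J}\lambda_{jt}=1$; arrivals and choices at different periods are independent. If assortment $S\subseteq\mathcal N$ is offered to a type-$j$ customer, she chooses product $i$ with probability $\phi_{ij}(S)\ge0$ and chooses nothing with probability $1-\sum_{i\in\mathcal N}\phi_{ij}(S)\ge 0$; $\phi_{ij}(S)=0$ for $i\notin S$. Substitutability: $\phi_{ij}(S\cup\{\ell\})\le\phi_{ij}(S)$ for all $i\in S$, $\ell\notin S$, $j\in\mathcal J$, $S\subseteq\mathcal N$. Policies. A sampling-based inventory-agnostic policy $\mu$ is given by mutually independent random assortments $(S^\mu_{jt}: j\in\mathcal J, t\in\mathcal T)$, independent of arrivals and choices; if a type-$j$ customer arrives at period $t$, the assortment $S^\mu_{jt}$ is offered regardless of remaining inventories. If the customer chooses a product with no remaining inventory she leaves without a purchase; otherwise, if she chooses product $i$, one unit of its inventory is consumed and revenue $r_i$ is collected. $\mathrm{rev}(\mu)$ is the total expected revenue of $\mu$ over the selling horizon. Explicitly, with $\varphi^\mu_{it}=\sum_{j\in\mathcal J}\lambda_{jt}\sum_{S\subseteq\mathcal N}\mathbb P\{S^\mu_{jt}=S\}\,\phi_{ij}(S)$ and, for each $i$, independent Bernoulli random variables $B^\mu_{it}$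 ($t\in\mathcal T$) with parameters $\varphi^\mu_{it}$, $\mathrm{rev}(\mu)=\sum_{i\in\mathcal N}r_i\,\mathbb E\{\min\{c_i,\sum_{t\in\mathcal T}B^\mu_{it}\}\}$. A policy offers a deterministic sequence of assortments if every $S^\mu_{jt}$ is deterministic. $M_{jt}(\mu,S)$ denotes the policy obtained from $\mu$ by replacing $S^\mu_{jt}$ with the deterministic assortment $S$, keeping all else unchanged. $\mathrm{opt}^{\mathrm{det}}$ is the maximum of $\mathrm{rev}(\mu)$ over all inventory-agnostic policies that offer a deterministic sequence of assortments (equivalently, over all sampling-based inventory-agnostic policies).
   Formalization: The constant in the O(·) bound on updates is uniform over all instances and all ε in (0, ε₀], for each ε₀ > 0; one constant for all ε > 0 is impossible, since for m = T = 1 one update can occur with Σ rᵢcᵢ / R̄ = 2 + 4ε for arbitrarily large ε. *)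

theory Defs
  imports "HOL-Probability.Probability"
begin

section \<open>The model\<close>

record model =
  n_products :: nat
  n_types :: nat
  n_periods :: nat
  revenue :: "nat \<Rightarrow> real"                      (* r i *)
  inventory :: "nat \<Rightarrow> nat"                     (* c i *)
  arrival :: "nat \<Rightarrow> nat \<Rightarrow> real"               (* lambda j t *)
  choice :: "nat \<Rightarrow> nat \<Rightarrow> nat set \<Rightarrow> real"     (* phi i j S *)

definition products :: "model \<Rightarrow> nat set" where
  "products M = {1..n_products M}"

definition types :: "model \<Rightarrow> nat set" where
  "types M = {1..n_types M}"

definition periods :: "model \<Rightarrow> nat set" where
  "periods M = {1..n_periods M}"

definition substitutable :: "model \<Rightarrow> bool" where
  "substitutable M \<longleftrightarrow>
     (\<forall>j\<in>types M. \<forall>S. S \<subseteq> products M \<longrightarrow>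
        (\<forall>i\<in>S. \<forall>l\<in>products M - S. choice M i j (S \<union> {l}) \<le> choice M i j S))"

definition valid_model :: "model \<Rightarrow> bool" where
  "valid_model M \<longleftrightarrow>
     (\<forall>i\<in>products M. 0 \<le> revenue M i) \<and>
     (\<forall>t\<in>periods M. (\<forall>j\<in>types M. 0 \<le> arrival M j t) \<and> (\<Sum>j\<in>types M. arrival M j t) = 1) \<and>
     (\<forall>j\<in>types M. \<forall>S. S \<subseteq> products M \<longrightarrow>
        (\<forall>i\<in>products M. 0 \<le> choice M i j S) \<and>
        (\<Sum>i\<in>products M. choice M i j S) \<le> 1 \<and>
        (\<forall>i\<in>products M - S. choice M i j S = 0)) \<and>
     substitutable M"

section \<open>Policies\<close>

text \<open>
  A sampling-based inventory-agnostic policy is given by the laws of its random assortments;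
  as these are mutually independent, and independent of arrivals and choices, their joint law
  carries no further information. Values at indices outside \<open>types M\<close> and \<open>periods M\<close> are never used.
\<close>

type_synonym policy = "nat \<Rightarrow> nat \<Rightarrow> nat set pmf"

definition is_policy :: "model \<Rightarrow> policy \<Rightarrow> bool" where
  "is_policy M mu \<longleftrightarrow> (\<forall>j\<in>types M. \<forall>t\<in>periods M. set_pmf (mu j t) \<subseteq> Pow (products M))"

definition deterministic :: "model \<Rightarrow> policy \<Rightarrow> bool" where
  "deterministic M mu \<longleftrightarrow> (\<forall>j\<in>types M. \<forall>t\<in>periods M. \<exists>S. mu j t = return_pmf S)"

definition exchange :: "policy \<Rightarrow> nat \<Rightarrow> nat \<Rightarrow> nat set \<Rightarrow> policy" where
  "exchange mu j t S = mu(j := (mu j)(t := return_pmf S))"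

section \<open>Total expected revenue\<close>

definition arrival_pmf :: "model \<Rightarrow> nat \<Rightarrow> nat pmf" where
  "arrival_pmf M t = embed_pmf (\<lambda>j. if j \<in> types M then arrival M j t else 0)"

text \<open>\<open>None\<close> stands for choosing nothing.\<close>

definition choice_pmf :: "model \<Rightarrow> nat \<Rightarrow> nat set \<Rightarrow> nat option pmf" where
  "choice_pmf M j S = embed_pmf (\<lambda>x. case x of
       None \<Rightarrow> 1 - (\<Sum>i\<in>products M. choice M i j S)
     | Some i \<Rightarrow> if i \<in> products M then choice M i j S else 0)"

definition period_pmf :: "model \<Rightarrow> policy \<Rightarrow> nat \<Rightarrow> nat option pmf" where
  "period_pmf M mu t =
     bind_pmf (arrival_pmf M t) (\<lambda>j. bind_pmf (mu j t) (\<lambda>S. choice_pmf M j S))"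

text \<open>Revenue collected along a sequence of choices, starting from the inventories \<open>c\<close>.\<close>

fun collected :: "(nat \<Rightarrow> real) \<Rightarrow> (nat \<Rightarrow> nat) \<Rightarrow> nat option list \<Rightarrow> real" where
  "collected r c [] = 0"
| "collected r c (None # xs) = collected r c xs"
| "collected r c (Some i # xs) =
     (if c i > 0 then r i + collected r (c(i := c i - 1)) xs else collected r c xs)"

definition exp_rev :: "model \<Rightarrow> policy \<Rightarrow> real" where
  "exp_rev M mu =
     measure_pmf.expectation (Pi_pmf (periods M) None (period_pmf M mu))
       (\<lambda>w. collected (revenue M) (inventory M) (map w [1..<Suc (n_periods M)]))"

definition opt_det :: "model \<Rightarrow> real" where
  "opt_det M = Max (exp_rev M ` {mu. is_policy M mu \<and> deterministic M mu})"

section \<open>Local exchange algorithm\<close>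

definition best_exchanges :: "model \<Rightarrow> policy \<Rightarrow> (nat \<Rightarrow> nat \<Rightarrow> nat set) \<Rightarrow> bool" where
  "best_exchanges M mu Sstar \<longleftrightarrow>
     (\<forall>j\<in>types M. \<forall>t\<in>periods M.
        is_arg_max (\<lambda>S. exp_rev M (exchange mu j t S)) (\<lambda>S. S \<subseteq> products M) (Sstar j t))"

definition improves :: "model \<Rightarrow> real \<Rightarrow> policy \<Rightarrow> policy \<Rightarrow> bool" where
  "improves M eps mu mu' \<longleftrightarrow>
     exp_rev M mu' \<ge> (1 + eps * (4 / (real (n_types M) * real (n_periods M)))) * exp_rev M mu"

text \<open>
  Both the maximisers and the improving pair are chosen arbitrarily in every iteration, so one
  iteration is a relation, and a run with \<open>k\<close> updates is a chain in \<open>update M eps ^^ k\<close>.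
\<close>

definition update :: "model \<Rightarrow> real \<Rightarrow> policy \<Rightarrow> policy \<Rightarrow> bool" where
  "update M eps mu mu' \<longleftrightarrow>
     (\<exists>Sstar. best_exchanges M mu Sstar \<and>
        (\<exists>j\<in>types M. \<exists>t\<in>periods M.
           improves M eps mu (exchange mu j t (Sstar j t)) \<and> mu' = exchange mu j t (Sstar j t)))"

definition stops_at :: "model \<Rightarrow> real \<Rightarrow> policy \<Rightarrow> bool" where
  "stops_at M eps mu \<longleftrightarrow>
     (\<exists>Sstar. best_exchanges M mu Sstar \<and>
        (\<forall>j\<in>types M. \<forall>t\<in>periods M. \<not> improves M eps mu (exchange mu j t (Sstar j t))))"

definition initial_policy :: "model \<Rightarrow> policy \<Rightarrow> bool" where
  "initial_policy M mu0 \<longleftrightarrow> is_policy M mu0 \<and> deterministic M mu0 \<and> exp_rev M mu0 > 0"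

section \<open>Closed form of the expected revenue\<close>

definition purchase_prob :: "model \<Rightarrow> policy \<Rightarrow> nat \<Rightarrow> nat \<Rightarrow> real" where
  "purchase_prob M mu i t =
     (\<Sum>j\<in>types M. arrival M j t * (\<Sum>S\<in>Pow (products M). pmf (mu j t) S * choice M i j S))"

lemma pmf_embed_finite:
  fixes f :: "'a \<Rightarrow> real"
  assumes "finite A" "\<And>x. x \<notin> A \<Longrightarrow> f x = 0" "\<And>x. x \<in> A \<Longrightarrow> f x \<ge> 0" "sum f A = 1"
  shows "pmf (embed_pmf f) x = f x"
proof (rule pmf_embed_pmf)
  show "0 \<le> f x" for x using assms by (cases "x \<in> A") auto
  have "(\<integral>\<^sup>+x. ennreal (f x) \<partial>count_space UNIV) = (\<integral>\<^sup>+x. ennreal (f x) \<partial>count_space A)"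
    by (intro nn_integral_count_space_eq) (auto simp: assms)
  also have "\<dots> = (\<Sum>x\<in>A. ennreal (f x))"
    using assms by (simp add: nn_integral_count_space_finite)
  also have "\<dots> = 1" using assms by (simp add: sum_ennreal)
  finally show "(\<integral>\<^sup>+x. ennreal (f x) \<partial>count_space UNIV) = 1" .
qed

lemma pmf_arrival_pmf:
  assumes "valid_model M" "t \<in> periods M"
  shows "pmf (arrival_pmf M t) j = (if j \<in> types M then arrival M j t else 0)"
  unfolding arrival_pmf_def
  by (rule pmf_embed_finite[where A = "types M"])
     (use assms in \<open>auto simp: valid_model_def types_def\<close>)

lemma pmf_choice_pmf:
  assumes "valid_model M" "j \<in> types M" "S \<subseteq> products M"
  shows "pmf (choice_pmf M j S) x = (case x of
       None \<Rightarrow> 1 - (\<Sum>i\<in>products M. choice M i j S)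
     | Some i \<Rightarrow> if i \<in> products M then choice M i j S else 0)"
  unfolding choice_pmf_def
proof (rule pmf_embed_finite[where A = "insert None (Some ` products M)"])
  show "finite (insert None (Some ` products M))" by (simp add: products_def)
qed (use assms in \<open>auto simp: valid_model_def products_def sum.reindex split: option.splits\<close>)

lemma set_arrival_pmf:
  assumes "valid_model M" "t \<in> periods M"
  shows "set_pmf (arrival_pmf M t) \<subseteq> types M"
  using pmf_arrival_pmf[OF assms] by (force simp: set_pmf_eq split: if_splits)

lemma pmf_period_pmf:
  assumes "valid_model M" "is_policy M mu" "t \<in> periods M" "i \<in> products M"
  shows "pmf (period_pmf M mu t) (Some i) = purchase_prob M mu i t"
proof -
  have "pmf (period_pmf M mu t) (Some i) =
      (\<Sum>j\<in>types M. arrival M j t * pmf (bind_pmf (mu j t) (choice_pmf M j)) (Some i))"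
    unfolding period_pmf_def pmf_bind
    by (subst integral_measure_pmf[where A = "types M"])
       (use set_arrival_pmf[OF assms(1,3)] in
          \<open>auto simp: types_def pmf_arrival_pmf[OF assms(1,3)] intro!: sum.cong\<close>)
  also have "\<dots> = purchase_prob M mu i t"
    unfolding purchase_prob_def
  proof (intro sum.cong refl arg_cong2[where f = times])
    fix j assume j: "j \<in> types M"
    show "pmf (bind_pmf (mu j t) (choice_pmf M j)) (Some i) =
        (\<Sum>S\<in>Pow (products M). pmf (mu j t) S * choice M i j S)"
      unfolding pmf_bind
      by (subst integral_measure_pmf[where A = "Pow (products M)"])
         (use assms j in \<open>auto simp: is_policy_def pmf_choice_pmf products_def intro!: sum.cong\<close>)
  qed
  finally show ?thesis .
qed

lemma set_period_pmf:
  assumes "valid_model M" "is_policy M mu" "t \<in> periods M"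
  shows "set_pmf (period_pmf M mu t) \<subseteq> insert None (Some ` products M)"
proof
  fix x assume "x \<in> set_pmf (period_pmf M mu t)"
  then obtain j S where j: "j \<in> set_pmf (arrival_pmf M t)" and S: "S \<in> set_pmf (mu j t)"
    and x: "x \<in> set_pmf (choice_pmf M j S)"
    by (auto simp: period_pmf_def)
  have j': "j \<in> types M" using j set_arrival_pmf[OF assms(1,3)] by auto
  have "S \<subseteq> products M" using assms S j' by (auto simp: is_policy_def)
  then show "x \<in> insert None (Some ` products M)"
    using x pmf_choice_pmf[OF assms(1) j', of S x]
    by (auto simp: set_pmf_eq split: option.splits if_splits)
qed

lemma collected_eq:
  assumes "finite A" "set xs \<subseteq> insert None (Some ` A)"
  shows "collected r c xs = (\<Sum>i\<in>A. r i * real (min (c i) (count_list xs (Some i))))"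
  using assms(2)
proof (induction xs arbitrary: c)
  case (Cons x xs)
  show ?case
  proof (cases x)
    case None
    then show ?thesis using Cons by simp
  next
    case (Some k)
    have k: "k \<in> A" using Cons.prems Some by auto
    have *: "(\<Sum>i\<in>A. g i) = g k + (\<Sum>i\<in>A - {k}. g i)" for g :: "nat \<Rightarrow> real"
      using assms(1) k by (rule sum.remove)
    have 1: "(\<Sum>i\<in>A - {k}. r i * real (min ((c(k := c k - 1)) i) (count_list xs (Some i)))) =
        (\<Sum>i\<in>A - {k}. r i * real (min (c i) (count_list (x # xs) (Some i))))"
      by (intro sum.cong) (auto simp: Some)
    have 2: "(\<Sum>i\<in>A - {k}. r i * real (min (c i) (count_list xs (Some i)))) =
        (\<Sum>i\<in>A - {k}. r i * real (min (c i) (count_list (x # xs) (Some i))))"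
      by (intro sum.cong) (auto simp: Some)
    show ?thesis
    proof (cases "c k > 0")
      case True
      then have "real (min (c k) (count_list (x # xs) (Some k))) =
          1 + real (min (c k - 1) (count_list xs (Some k)))"
        by (cases "c k") (simp_all add: Some)
      then show ?thesis
        using True Cons.IH[of "c(k := c k - 1)"] Cons.prems 1
        by (simp add: Some * algebra_simps fun_upd_def)
    next
      case False
      then have "collected r c (x # xs) = (\<Sum>i\<in>A. r i * real (min (c i) (count_list xs (Some i))))"
        using Cons.IH[of c] Cons.prems by (simp add: Some)
      also have "\<dots> = (\<Sum>i\<in>A. r i * real (min (c i) (count_list (x # xs) (Some i))))"
        unfolding * 2 using False by simp
      finally show ?thesis .
    qed
  qed
qed simp

lemma count_list_map_eq:
  assumes "distinct ts"
  shows "count_list (map w ts) a = (\<Sum>t\<in>set ts. of_bool (w t = a))"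
  using assms by (induction ts) auto

theorem exp_rev_closed_form:
  assumes "valid_model M" "is_policy M mu"
  shows "exp_rev M mu =
    (\<Sum>i\<in>products M. revenue M i *
       measure_pmf.expectation
         (Pi_pmf (periods M) False (\<lambda>t. bernoulli_pmf (purchase_prob M mu i t)))
         (\<lambda>B. real (min (inventory M i) (\<Sum>t\<in>periods M. of_bool (B t)))))"
proof -
  let ?P = "Pi_pmf (periods M) None (period_pmf M mu)"
  have finT: "finite (periods M)" by (simp add: periods_def)
  have finN: "finite (products M)" by (simp add: products_def)
  have setP: "set_pmf ?P \<subseteq> PiE_dflt (periods M) None (\<lambda>t. insert None (Some ` products M))"
    unfolding set_Pi_pmf[OF finT] using set_period_pmf[OF assms] by (force simp: PiE_dflt_def)
  have finP: "finite (set_pmf ?P)"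
    by (rule finite_subset[OF setP]) (use finT finN in auto)
  have setl: "set [1..<Suc (n_periods M)] = periods M"
    by (auto simp: periods_def)
  have "exp_rev M mu = measure_pmf.expectation ?P (\<lambda>w. \<Sum>i\<in>products M.
      revenue M i * real (min (inventory M i) (\<Sum>t\<in>periods M. of_bool (w t = Some i))))"
    unfolding exp_rev_def
  proof (rule integral_cong_AE, simp, simp, rule AE_pmfI)
    fix w assume "w \<in> set_pmf ?P"
    then have "set (map w [1..<Suc (n_periods M)]) \<subseteq> insert None (Some ` products M)"
      using setP setl by (auto simp: PiE_dflt_def simp del: upt_Suc)
    then have "collected (revenue M) (inventory M) (map w [1..<Suc (n_periods M)]) =
       (\<Sum>i\<in>products M. revenue M i *
          real (min (inventory M i) (count_list (map w [1..<Suc (n_periods M)]) (Some i))))"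
      by (rule collected_eq[OF finN])
    moreover have "count_list (map w [1..<Suc (n_periods M)]) a =
        (\<Sum>t\<in>periods M. of_bool (w t = a))" for a
      using count_list_map_eq[OF distinct_upt, of w 1 "Suc (n_periods M)" a] unfolding setl .
    ultimately show "collected (revenue M) (inventory M) (map w [1..<Suc (n_periods M)]) =
       (\<Sum>i\<in>products M. revenue M i *
          real (min (inventory M i) (\<Sum>t\<in>periods M. of_bool (w t = Some i))))"
      by (simp only:)
  qed
  also have "\<dots> = (\<Sum>i\<in>products M. revenue M i * measure_pmf.expectation ?P
      (\<lambda>w. real (min (inventory M i) (\<Sum>t\<in>periods M. of_bool (w t = Some i)))))"
    by (subst Bochner_Integration.integral_sum)
       (auto intro!: integrable_measure_pmf_finite finP)
  also have "\<dots> = (\<Sum>i\<in>products M. revenue M i *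
       measure_pmf.expectation
         (Pi_pmf (periods M) False (\<lambda>t. bernoulli_pmf (purchase_prob M mu i t)))
         (\<lambda>B. real (min (inventory M i) (\<Sum>t\<in>periods M. of_bool (B t)))))"
  proof (intro sum.cong refl arg_cong2[where f = times])
    fix i assume i: "i \<in> products M"
    have bern: "map_pmf (\<lambda>x. x = Some i) (period_pmf M mu t) = bernoulli_pmf (purchase_prob M mu i t)"
      if t: "t \<in> periods M" for t
    proof -
      have p: "purchase_prob M mu i t = pmf (period_pmf M mu t) (Some i)"
        using pmf_period_pmf[OF assms t i] by simp
      have T: "pmf (map_pmf (\<lambda>x. x = Some i) (period_pmf M mu t)) True = purchase_prob M mu i t"
        by (simp add: p pmf_map vimage_def pmf.rep_eq)
      then have F: "pmf (map_pmf (\<lambda>x. x = Some i) (period_pmf M mu t)) False = 1 - purchase_prob M mu i t"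
        by (simp add: pmf_False_conv_True)
      have "0 \<le> purchase_prob M mu i t" "purchase_prob M mu i t \<le> 1"
        unfolding p by (auto simp: pmf_le_1)
      with T F show ?thesis
        by (intro pmf_eqI) (metis (full_types) pmf_bernoulli_True pmf_bernoulli_False)
    qed
    have "Pi_pmf (periods M) False (\<lambda>t. bernoulli_pmf (purchase_prob M mu i t)) =
        Pi_pmf (periods M) False (\<lambda>t. map_pmf (\<lambda>x. x = Some i) (period_pmf M mu t))"
      by (intro Pi_pmf_cong) (auto simp: bern)
    also have "\<dots> = map_pmf (\<lambda>w. (\<lambda>x. x = Some i) \<circ> w) ?P"
      by (rule Pi_pmf_map[OF finT]) simp
    finally show "measure_pmf.expectation ?P
          (\<lambda>w. real (min (inventory M i) (\<Sum>t\<in>periods M. of_bool (w t = Some i)))) =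
        measure_pmf.expectation
         (Pi_pmf (periods M) False (\<lambda>t. bernoulli_pmf (purchase_prob M mu i t)))
         (\<lambda>B. real (min (inventory M i) (\<Sum>t\<in>periods M. of_bool (B t))))"
      by simp
  qed
  finally show ?thesis .
qed

text \<open>The maximum in \<open>opt_det\<close> is over a finite non-empty set of values.\<close>

lemma exp_rev_cong:
  assumes "valid_model M" "\<And>j t. j \<in> types M \<Longrightarrow> t \<in> periods M \<Longrightarrow> mu j t = mu' j t"
  shows "exp_rev M mu = exp_rev M mu'"
proof -
  have "period_pmf M mu t = period_pmf M mu' t" if "t \<in> periods M" for t
    unfolding period_pmf_def
  proof (rule bind_pmf_cong[OF refl])
    fix j assume "j \<in> set_pmf (arrival_pmf M t)"
    then have "mu j t = mu' j t" using assms set_arrival_pmf[OF assms(1) that] that by auto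
    then show "mu j t \<bind> choice_pmf M j = mu' j t \<bind> choice_pmf M j" by simp
  qed
  then have "Pi_pmf (periods M) None (period_pmf M mu) = Pi_pmf (periods M) None (period_pmf M mu')"
    by (intro Pi_pmf_cong) auto
  then show ?thesis by (simp add: exp_rev_def)
qed

lemma opt_det_well_defined:
  assumes "valid_model M"
  shows "finite (exp_rev M ` {mu. is_policy M mu \<and> deterministic M mu})"
    and "exp_rev M ` {mu. is_policy M mu \<and> deterministic M mu} \<noteq> {}"
proof -
  let ?F = "(types M \<times> periods M) \<rightarrow>\<^sub>E Pow (products M)"
  have "exp_rev M ` {mu. is_policy M mu \<and> deterministic M mu} \<subseteq>
      (\<lambda>f. exp_rev M (\<lambda>j t. return_pmf (f (j, t)))) ` ?F"
  proof safe
    fix mu assume p: "is_policy M mu" and d: "deterministic M mu"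
    define f where "f = (\<lambda>(j, t)\<in>types M \<times> periods M. SOME S. mu j t = return_pmf S)"
    have f: "mu j t = return_pmf (f (j, t))" if "j \<in> types M" "t \<in> periods M" for j t
      using d that someI_ex[of "\<lambda>S. mu j t = return_pmf S"] by (auto simp: f_def deterministic_def)
    have "f \<in> ?F"
    proof (rule PiE_I)
      fix x assume x: "x \<in> types M \<times> periods M"
      then have "set_pmf (mu (fst x) (snd x)) \<subseteq> Pow (products M)"
        using p x by (simp add: is_policy_def mem_Times_iff)
      then show "f x \<in> Pow (products M)"
        using f[of "fst x" "snd x"] x by auto
    qed (auto simp: f_def)
    moreover have "exp_rev M mu = exp_rev M (\<lambda>j t. return_pmf (f (j, t)))"
      by (rule exp_rev_cong[OF assms]) (rule f)
    ultimately show "exp_rev M mu \<in> (\<lambda>f. exp_rev M (\<lambda>j t. return_pmf (f (j, t)))) ` ?F"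
      by blast
  qed
  moreover have "finite ?F"
    by (intro finite_PiE) (auto simp: types_def periods_def products_def)
  ultimately show "finite (exp_rev M ` {mu. is_policy M mu \<and> deterministic M mu})"
    using finite_surj by blast
  have "is_policy M (\<lambda>j t. return_pmf {}) \<and> deterministic M (\<lambda>j t. return_pmf {})"
    by (auto simp: is_policy_def deterministic_def)
  then show "exp_rev M ` {mu. is_policy M mu \<and> deterministic M mu} \<noteq> {}" by blast
qed

end

theory Submission
  imports Defs
begin

text \<open>
  Fix a product with inventory \<open>c\<close>, let \<open>N\<close> be the number of customers choosing it under \<open>\<mu>\<close>, with
  choice probabilities \<open>p t\<close> and choice indicators \<open>B t\<close>. Its expected sales \<open>F p = E (min c N)\<close> are
  multilinear in \<open>p\<close>, with partial derivative \<open>D t = P (N - B t < c)\<close>, so exchanging one assortment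
  changes \<open>F\<close> by \<open>D t\<close> times the change of \<open>p t\<close>. Exchanging, one at a time, every assortment of
  \<open>\<mu>\<close> for that of an optimal policy with probabilities \<open>q t\<close> therefore gains \<open>\<Sum>t. (q t - p t) * D t\<close>
  in total. Here \<open>\<Sum>t. p t * D t = E (N; N \<le> c) \<le> F p\<close>, while \<open>\<Sum>t. q t * D t\<close> is at least
  \<open>(\<Sum>t. q t) * P (N < c) \<ge> F q - F p\<close>. Hence the total gain is at least \<open>opt - 2 rev \<mu>\<close>, and at a
  stopping policy it is at most \<open>4 \<epsilon> rev \<mu>\<close>.
\<close>

section \<open>Expectations of functions of a sum of independent Bernoulli variables\<close>

text \<open>The number of successes is Poisson binomial. The integrand \<open>h\<close> is arbitrary
  so that conditioning on one trial can turn it into the shift \<open>h (Suc n)\<close>.\<close>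

definition count_exp :: "'a set \<Rightarrow> ('a \<Rightarrow> real) \<Rightarrow> (nat \<Rightarrow> real) \<Rightarrow> real" where
  "count_exp A p h = measure_pmf.expectation (Pi_pmf A False (\<lambda>t. bernoulli_pmf (p t)))
     (\<lambda>B. h (\<Sum>t\<in>A. of_bool (B t)))"

lemma finite_set_Pi_bernoulli:
  assumes "finite A"
  shows "finite (set_pmf (Pi_pmf A False (\<lambda>t. bernoulli_pmf (p t))))"
  by (rule finite_subset[OF set_Pi_pmf_subset'[OF assms]]) (auto intro: assms)

lemma count_exp_cong:
  assumes "finite A" "\<And>t. t \<in> A \<Longrightarrow> p t = q t"
  shows "count_exp A p h = count_exp A q h"
proof -
  have "Pi_pmf A False (\<lambda>t. bernoulli_pmf (p t)) = Pi_pmf A False (\<lambda>t. bernoulli_pmf (q t))"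
    by (intro Pi_pmf_cong) (auto simp: assms)
  then show ?thesis by (simp add: count_exp_def)
qed

lemma count_exp_empty [simp]: "count_exp {} p h = h 0"
  by (simp add: count_exp_def)

text \<open>Condition on trial \<open>a\<close>, which is independent of the others. The bounds on
  \<open>p a\<close> ensure that the weights are right, since \<open>bernoulli_pmf\<close> clips its
  parameter to [0, 1].\<close>

lemma count_exp_insert:
  assumes "finite A" "a \<notin> A" "0 \<le> p a" "p a \<le> 1"
  shows "count_exp (insert a A) p h =
    (1 - p a) * count_exp A p h + p a * count_exp A p (\<lambda>n. h (Suc n))"
proof -
  let ?P = "Pi_pmf A False (\<lambda>t. bernoulli_pmf (p t))"
  have "count_exp (insert a A) p h = measure_pmf.expectation
      (bernoulli_pmf (p a) \<bind> (\<lambda>b. map_pmf (\<lambda>B. B(a := b)) ?P))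
      (\<lambda>B. h (\<Sum>t\<in>insert a A. of_bool (B t)))"
    unfolding count_exp_def Pi_pmf_insert'[OF assms(1,2)] map_pmf_def ..
  also have "\<dots> = (\<Sum>b\<in>UNIV. pmf (bernoulli_pmf (p a)) b *
      measure_pmf.expectation ?P (\<lambda>B. h (\<Sum>t\<in>insert a A. of_bool ((B(a := b)) t))))"
    by (subst pmf_expectation_bind[where A = UNIV])
       (simp_all add: finite_set_Pi_bernoulli assms(1) del: fun_upd_apply sum_of_bool_eq)
  also have "(\<lambda>b B. h (\<Sum>t\<in>insert a A. of_bool ((B(a := b)) t))) =
      (\<lambda>b B. h (of_bool b + (\<Sum>t\<in>A. of_bool (B t))))"
  proof (intro ext)
    fix b and B :: "'a \<Rightarrow> bool"
    have "(\<Sum>t\<in>A. of_bool ((B(a := b)) t)) = (\<Sum>t\<in>A. of_bool (B t) :: nat)"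
      by (rule sum.cong) (use assms(2) in auto)
    then show "h (\<Sum>t\<in>insert a A. of_bool ((B(a := b)) t)) =
        h (of_bool b + (\<Sum>t\<in>A. of_bool (B t)))"
      by (simp only: sum.insert[OF assms(1,2)] fun_upd_same)
  qed
  finally show ?thesis
    using assms(3,4) by (simp add: UNIV_bool count_exp_def)
qed

lemma count_exp_add:
  assumes "finite A"
  shows "count_exp A p (\<lambda>n. f n + g n) = count_exp A p f + count_exp A p g"
  unfolding count_exp_def
  by (rule Bochner_Integration.integral_add)
     (auto intro!: integrable_measure_pmf_finite finite_set_Pi_bernoulli assms)

lemma count_exp_cmult: "count_exp A p (\<lambda>n. k * h n) = k * count_exp A p h"
  by (simp add: count_exp_def)

lemma count_exp_const [simp]: "count_exp A p (\<lambda>_. k) = k"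
  by (simp add: count_exp_def)

lemma count_exp_mono:
  assumes "finite A" "\<And>n. f n \<le> g n"
  shows "count_exp A p f \<le> count_exp A p g"
  unfolding count_exp_def
  by (rule integral_mono)
     (auto intro!: integrable_measure_pmf_finite finite_set_Pi_bernoulli assms)

lemma count_exp_nonneg:
  assumes "finite A" "\<And>n. 0 \<le> h n"
  shows "0 \<le> count_exp A p h"
  using count_exp_mono[OF assms, of p] by simp

text \<open>Neither expectation over \<open>A - {a}\<close> involves \<open>p a\<close>, so the
  whole is affine in \<open>p a\<close>, with the expected forward difference of \<open>h\<close> as
  slope.\<close>

lemma count_exp_remove:
  assumes "finite A" "a \<in> A" "0 \<le> p a" "p a \<le> 1"
  shows "count_exp A p h = count_exp (A - {a}) p h +
    p a * count_exp (A - {a}) p (\<lambda>n. h (Suc n) - h n)"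
proof -
  have "count_exp (A - {a}) p (\<lambda>n. h (Suc n)) =
      count_exp (A - {a}) p h + count_exp (A - {a}) p (\<lambda>n. h (Suc n) - h n)"
    by (subst count_exp_add[symmetric]) (use assms(1) in auto)
  moreover have "count_exp A p h = (1 - p a) * count_exp (A - {a}) p h +
      p a * count_exp (A - {a}) p (\<lambda>n. h (Suc n))"
    using count_exp_insert[of "A - {a}" a p h] assms by (simp add: insert_absorb)
  ultimately show ?thesis by (simp add: algebra_simps)
qed

text \<open>By independence each summand is E (B t * g (N - B t)) = E (B t * g (N - 1)), and the
  indicators B t add up to N. The induction keeps \<open>g\<close> arbitrary because a success of
  the new trial shifts it.\<close>

lemma count_exp_size_bias:
  assumes "finite A" "\<And>t. t \<in> A \<Longrightarrow> 0 \<le> p t \<and> p t \<le> 1"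
  shows "(\<Sum>t\<in>A. p t * count_exp (A - {t}) p g) = count_exp A p (\<lambda>n. real n * g (n - 1))"
  using assms
proof (induction A arbitrary: g)
  case (insert a A)
  have p: "0 \<le> p a" "p a \<le> 1" using insert.prems by auto
  have step: "count_exp (insert a A - {t}) p g =
      (1 - p a) * count_exp (A - {t}) p g + p a * count_exp (A - {t}) p (\<lambda>n. g (Suc n))"
    if "t \<in> A" for t
  proof -
    have "insert a A - {t} = insert a (A - {t})" using that insert.hyps by auto
    then show ?thesis using insert.hyps p by (simp add: count_exp_insert)
  qed
  have "(\<Sum>t\<in>insert a A. p t * count_exp (insert a A - {t}) p g) =
      p a * count_exp A p g + (\<Sum>t\<in>A. p t * count_exp (insert a A - {t}) p g)"
    using insert.hyps by simp
  also have "(\<Sum>t\<in>A. p t * count_exp (insert a A - {t}) p g) =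
      (\<Sum>t\<in>A. (1 - p a) * (p t * count_exp (A - {t}) p g) +
        p a * (p t * count_exp (A - {t}) p (\<lambda>n. g (Suc n))))"
    by (intro sum.cong refl, subst step) (simp_all add: algebra_simps)
  also have "p a * count_exp A p g + \<dots> =
      p a * count_exp A p g + (1 - p a) * (\<Sum>t\<in>A. p t * count_exp (A - {t}) p g) +
      p a * (\<Sum>t\<in>A. p t * count_exp (A - {t}) p (\<lambda>n. g (Suc n)))"
    by (simp only: sum.distrib sum_distrib_left add.assoc)
  also have "(\<Sum>t\<in>A. p t * count_exp (A - {t}) p g) = count_exp A p (\<lambda>n. real n * g (n - 1))"
    using insert by auto
  also have "(\<Sum>t\<in>A. p t * count_exp (A - {t}) p (\<lambda>n. g (Suc n))) =
      count_exp A p (\<lambda>n. real n * g (Suc (n - 1)))"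
    using insert by auto
  \<comment> \<open>The factor \<open>real n\<close> hides n = 0, the only argument where truncated
    subtraction makes \<open>Suc (n - 1)\<close> differ from \<open>n\<close>.\<close>
  also have "(\<lambda>n. real n * g (Suc (n - 1))) = (\<lambda>n. real n * g n)"
    by (rule ext, rename_tac n, case_tac n) auto
  also have "p a * count_exp A p g + (1 - p a) * count_exp A p (\<lambda>n. real n * g (n - 1)) +
      p a * count_exp A p (\<lambda>n. real n * g n) =
      (1 - p a) * count_exp A p (\<lambda>n. real n * g (n - 1)) +
      p a * count_exp A p (\<lambda>n. g n + real n * g n)"
    using insert.hyps by (simp add: count_exp_add algebra_simps)
  also have "\<dots> = count_exp (insert a A) p (\<lambda>n. real n * g (n - 1))"
    using insert.hyps p by (simp add: count_exp_insert algebra_simps)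
  finally show ?case .
qed simp

section \<open>Expected sales and slack probabilities\<close>

text \<open>The \<open>D t\<close> of the overview. Leaving out \<open>t\<close> makes it
  independent of \<open>p t\<close>, hence equal for two policies that differ only in period
  \<open>t\<close>.\<close>

definition slack_prob :: "'a set \<Rightarrow> ('a \<Rightarrow> real) \<Rightarrow> nat \<Rightarrow> 'a \<Rightarrow> real" where
  "slack_prob A p c t = count_exp (A - {t}) p (\<lambda>n. of_bool (n < c))"

text \<open>One more customer adds a sale exactly when fewer than \<open>c\<close> others chose the
  product, so the slope in \<open>p a\<close> is a slack probability.\<close>

lemma count_exp_min_remove:
  assumes "finite A" "a \<in> A" "0 \<le> p a" "p a \<le> 1"
  shows "count_exp A p (\<lambda>n. real (min c n)) =
    count_exp (A - {a}) p (\<lambda>n. real (min c n)) + p a * slack_prob A p c a"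
proof -
  have "(\<lambda>n. real (min c (Suc n)) - real (min c n)) = (\<lambda>n. of_bool (n < c))"
    by (auto simp: min_def)
  then show ?thesis
    using count_exp_remove[of A a p "\<lambda>n. real (min c n)"] assms
    by (simp only: slack_prob_def)
qed

text \<open>Size biasing yields the integrand that is n for n \<le> c and 0 beyond, which lies below
  \<open>min c n\<close>.\<close>

lemma sum_slack_prob_le:
  assumes "finite A" "\<And>t. t \<in> A \<Longrightarrow> 0 \<le> p t \<and> p t \<le> 1"
  shows "(\<Sum>t\<in>A. p t * slack_prob A p c t) \<le> count_exp A p (\<lambda>n. real (min c n))"
proof -
  have "(\<Sum>t\<in>A. p t * slack_prob A p c t) = count_exp A p (\<lambda>n. real n * of_bool (n - 1 < c))"
    unfolding slack_prob_def by (rule count_exp_size_bias[OF assms])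
  also have "\<dots> \<le> count_exp A p (\<lambda>n. real (min c n))"
    by (rule count_exp_mono[OF assms(1)]) (auto simp: of_bool_def)
  finally show ?thesis .
qed

lemma count_exp_min_le_sum:
  assumes "finite A" "\<And>t. t \<in> A \<Longrightarrow> 0 \<le> q t \<and> q t \<le> 1"
  shows "count_exp A q (\<lambda>n. real (min c n)) \<le> sum q A"
proof -
  have "count_exp A q (\<lambda>n. real (min c n)) \<le> count_exp A q (\<lambda>n. real n * 1)"
    by (rule count_exp_mono[OF assms(1)]) auto
  also have "\<dots> = sum q A"
    \<comment> \<open>With constant \<open>g\<close>, size biasing says that the expected count is
      the sum of the probabilities.\<close>
    using count_exp_size_bias[OF assms, where g = "\<lambda>_. 1"] by simp
  finally show ?thesis .
qed

text \<open>With d = P (N < c) under \<open>p\<close>, split F q = (1 - d) * F q + d * F q and bound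
  the first F q by c, the second by the sum of \<open>q\<close>. Then (1 - d) * c \<le> F p because
  all c units sell when N \<ge> c, and d is at most every slack probability.\<close>

lemma count_exp_min_diff_le:
  assumes "finite A" "\<And>t. t \<in> A \<Longrightarrow> 0 \<le> p t \<and> p t \<le> 1"
    and q: "\<And>t. t \<in> A \<Longrightarrow> 0 \<le> q t \<and> q t \<le> 1"
  shows "count_exp A q (\<lambda>n. real (min c n)) - count_exp A p (\<lambda>n. real (min c n)) \<le>
    (\<Sum>t\<in>A. q t * slack_prob A p c t)"
proof -
  let ?d = "count_exp A p (\<lambda>n. of_bool (n < c))"
  let ?F = "count_exp A q (\<lambda>n. real (min c n))"
  \<comment> \<open>Leaving out one customer can only make slack likelier: the indicator of n < c
    has forward differences at most 0.\<close>
  have slack: "?d \<le> slack_prob A p c t" if t: "t \<in> A" for t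
  proof -
    have "count_exp (A - {t}) p (\<lambda>n. of_bool (Suc n < c) - of_bool (n < c)) \<le>
        count_exp (A - {t}) p (\<lambda>_. 0)"
      by (rule count_exp_mono) (use assms(1) in auto)
    then have "p t * count_exp (A - {t}) p (\<lambda>n. of_bool (Suc n < c) - of_bool (n < c)) \<le> 0"
      using assms(2)[OF t] by (simp add: mult_nonneg_nonpos)
    then show ?thesis
      using count_exp_remove[OF assms(1) t, of p "\<lambda>n. of_bool (n < c)"] assms(2)[OF t]
      by (simp add: slack_prob_def)
  qed
  have d: "0 \<le> ?d" "?d \<le> 1"
    using count_exp_nonneg[OF assms(1)] count_exp_mono[OF assms(1), of "\<lambda>n. of_bool (n < c)" "\<lambda>_. 1" p]
    by auto
  have "?F \<le> count_exp A q (\<lambda>_. real c)"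
    by (rule count_exp_mono[OF assms(1)]) auto
  then have "(1 - ?d) * ?F \<le> (1 - ?d) * real c"
    using d by (intro mult_left_mono) auto
  moreover have "real c * (1 - ?d) \<le> count_exp A p (\<lambda>n. real (min c n))"
  proof -
    have "(\<lambda>n. real c * of_bool (n < c) + real c * of_bool (\<not> n < c)) = (\<lambda>_. real c)"
      by auto
    then have "real c = count_exp A p (\<lambda>n. real c * of_bool (n < c) + real c * of_bool (\<not> n < c))"
      by (simp only: count_exp_const)
    also have "\<dots> = real c * ?d + count_exp A p (\<lambda>n. real c * of_bool (\<not> n < c))"
      using assms(1) by (simp add: count_exp_add count_exp_cmult)
    also have "count_exp A p (\<lambda>n. real c * of_bool (\<not> n < c)) \<le>
        count_exp A p (\<lambda>n. real (min c n))"
      by (rule count_exp_mono[OF assms(1)]) auto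
    finally show ?thesis by (simp add: algebra_simps)
  qed
  moreover have "?d * ?F \<le> ?d * sum q A"
    using d count_exp_min_le_sum[OF assms(1) q] by (intro mult_left_mono) auto
  moreover have "?d * sum q A \<le> (\<Sum>t\<in>A. q t * slack_prob A p c t)"
    unfolding sum_distrib_left
  proof (rule sum_mono)
    fix t assume t: "t \<in> A"
    show "?d * q t \<le> q t * slack_prob A p c t"
      using mult_left_mono[OF slack[OF t], of "q t"] q[OF t] by (simp add: mult.commute)
  qed
  ultimately show ?thesis by (simp add: algebra_simps)
qed

section \<open>The effect of exchanges on expected revenue\<close>

text \<open>The choice probability of \<open>i\<close> given a type-\<open>j\<close> arrival at
  \<open>t\<close>. An exchange at (j, t) alters just this one term of the purchase
  probability.\<close>

definition assortment_prob :: "model \<Rightarrow> policy \<Rightarrow> nat \<Rightarrow> nat \<Rightarrow> nat \<Rightarrow> real" where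
  "assortment_prob M mu i j t = (\<Sum>S\<in>Pow (products M). pmf (mu j t) S * choice M i j S)"

lemma finite_model [simp]: "finite (products M)" "finite (types M)" "finite (periods M)"
  by (auto simp: products_def types_def periods_def)

lemma purchase_prob_alt:
  "purchase_prob M mu i t = (\<Sum>j\<in>types M. arrival M j t * assortment_prob M mu i j t)"
  by (simp add: purchase_prob_def assortment_prob_def)

lemma purchase_prob_bounds:
  assumes "valid_model M" "is_policy M mu" "i \<in> products M" "t \<in> periods M"
  shows "0 \<le> purchase_prob M mu i t \<and> purchase_prob M mu i t \<le> 1"
  using pmf_period_pmf[OF assms(1,2,4,3)] by (metis pmf_nonneg pmf_le_1)

lemma exp_rev_eq_count_exp:
  assumes "valid_model M" "is_policy M mu"
  shows "exp_rev M mu = (\<Sum>i\<in>products M. revenue M i *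
    count_exp (periods M) (purchase_prob M mu i) (\<lambda>n. real (min (inventory M i) n)))"
  using exp_rev_closed_form[OF assms] by (simp add: count_exp_def)

lemma exp_rev_nonneg:
  assumes "valid_model M" "is_policy M mu"
  shows "0 \<le> exp_rev M mu"
  unfolding exp_rev_eq_count_exp[OF assms]
  using assms(1) by (auto simp: valid_model_def intro!: sum_nonneg mult_nonneg_nonneg count_exp_nonneg)

lemma exp_rev_le:
  assumes "valid_model M" "is_policy M mu"
  shows "exp_rev M mu \<le> (\<Sum>i\<in>products M. revenue M i * real (inventory M i))"
  unfolding exp_rev_eq_count_exp[OF assms]
proof (intro sum_mono mult_left_mono)
  fix i
  show "count_exp (periods M) (purchase_prob M mu i) (\<lambda>n. real (min (inventory M i) n)) \<le>
      real (inventory M i)"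
    using count_exp_mono[of "periods M" "\<lambda>n. real (min (inventory M i) n)"
        "\<lambda>_. real (inventory M i)" "purchase_prob M mu i"] by simp
qed (use assms(1) in \<open>auto simp: valid_model_def\<close>)

lemma is_policy_exchange:
  assumes "is_policy M mu" "S \<subseteq> products M"
  shows "is_policy M (exchange mu j t S)"
  using assms by (auto simp: is_policy_def exchange_def)

lemma deterministic_obtain:
  assumes "is_policy M mu" "deterministic M mu"
  obtains A where "\<And>j t. j \<in> types M \<Longrightarrow> t \<in> periods M \<Longrightarrow> mu j t = return_pmf (A j t)"
    and "\<And>j t. j \<in> types M \<Longrightarrow> t \<in> periods M \<Longrightarrow> A j t \<subseteq> products M"
proof -
  have "\<exists>S. mu j t = return_pmf S \<and> S \<subseteq> products M" if "j \<in> types M" "t \<in> periods M" for j t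
    using assms that by (force simp: is_policy_def deterministic_def)
  then show ?thesis using that by metis
qed

lemma assortment_prob_return:
  assumes "mu j t = return_pmf S" "S \<subseteq> products M"
  shows "assortment_prob M mu i j t = choice M i j S"
proof -
  have "assortment_prob M mu i j t =
      (\<Sum>S'\<in>Pow (products M). if S' = S then choice M i j S' else 0)"
    unfolding assortment_prob_def by (rule sum.cong) (auto simp: assms(1))
  then show ?thesis using assms(2) by simp
qed

lemma purchase_prob_exchange_other:
  "t' \<noteq> t \<Longrightarrow> purchase_prob M (exchange mu j t S) i t' = purchase_prob M mu i t'"
  unfolding purchase_prob_def exchange_def by (intro sum.cong) auto

lemma purchase_prob_exchange_same:
  assumes "j \<in> types M" "S \<subseteq> products M"
  shows "purchase_prob M (exchange mu j t S) i t =
    purchase_prob M mu i t + arrival M j t * (choice M i j S - assortment_prob M mu i j t)"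
proof -
  have "assortment_prob M (exchange mu j t S) i j t = choice M i j S"
    by (rule assortment_prob_return) (use assms in \<open>auto simp: exchange_def\<close>)
  moreover have "assortment_prob M (exchange mu j t S) i j' t = assortment_prob M mu i j' t"
    if "j' \<noteq> j" for j'
    using that by (simp add: assortment_prob_def exchange_def)
  ultimately show ?thesis
    unfolding purchase_prob_alt by (simp add: sum.remove[OF _ assms(1)] algebra_simps)
qed

lemma exp_rev_exchange:
  assumes "valid_model M" "is_policy M mu" "j \<in> types M" "t \<in> periods M" "S \<subseteq> products M"
  shows "exp_rev M (exchange mu j t S) - exp_rev M mu = (\<Sum>i\<in>products M. revenue M i *
    (arrival M j t * (choice M i j S - assortment_prob M mu i j t) *
      slack_prob (periods M) (purchase_prob M mu i) (inventory M i) t))"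
proof -
  let ?mu = "exchange mu j t S"
  note pol = is_policy_exchange[OF assms(2,5), of j t]
  have "count_exp (periods M) (purchase_prob M ?mu i) (\<lambda>n. real (min c n)) -
      count_exp (periods M) (purchase_prob M mu i) (\<lambda>n. real (min c n)) =
      arrival M j t * (choice M i j S - assortment_prob M mu i j t) *
      slack_prob (periods M) (purchase_prob M mu i) c t"
    if i: "i \<in> products M" for i c
  proof -
    \<comment> \<open>Outside period \<open>t\<close> the two policies have the same purchase
      probabilities, so as affine functions of the one at \<open>t\<close> their expected sales
      share intercept and slope.\<close>
    have eq: "count_exp (periods M - {t}) (purchase_prob M ?mu i) h =
        count_exp (periods M - {t}) (purchase_prob M mu i) h" for h
      by (rule count_exp_cong) (auto simp: purchase_prob_exchange_other)
    show ?thesis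
      using count_exp_min_remove[OF _ assms(4), of "purchase_prob M ?mu i" c]
        count_exp_min_remove[OF _ assms(4), of "purchase_prob M mu i" c]
        purchase_prob_bounds[OF assms(1,2) i assms(4)] purchase_prob_bounds[OF assms(1) pol i assms(4)]
      by (simp add: slack_prob_def eq purchase_prob_exchange_same[OF assms(3,5)] algebra_simps)
  qed
  then show ?thesis
    unfolding exp_rev_eq_count_exp[OF assms(1,2)] exp_rev_eq_count_exp[OF assms(1) pol]
    by (simp add: sum_subtractf[symmetric] right_diff_distrib[symmetric])
qed

text \<open>Every exchange starts from \<open>mu\<close> itself, so all gains carry the same
  coefficients \<open>D\<close> and add up linearly. The factor 2 arises because F p is lost once in
  bounding the \<open>q\<close> part and once in bounding the \<open>p\<close> part.\<close>

lemma sum_exchange_ge: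
  assumes "valid_model M" "is_policy M mu" "is_policy M nu"
    and A: "\<And>j t. j \<in> types M \<Longrightarrow> t \<in> periods M \<Longrightarrow> nu j t = return_pmf (A j t)"
    and Asub: "\<And>j t. j \<in> types M \<Longrightarrow> t \<in> periods M \<Longrightarrow> A j t \<subseteq> products M"
  shows "exp_rev M nu - 2 * exp_rev M mu \<le>
    (\<Sum>t\<in>periods M. \<Sum>j\<in>types M. exp_rev M (exchange mu j t (A j t)) - exp_rev M mu)"
proof -
  define p where "p = purchase_prob M mu"
  define q where "q = purchase_prob M nu"
  define D where "D = (\<lambda>i. slack_prob (periods M) (p i) (inventory M i))"
  define F where "F = (\<lambda>x i. count_exp (periods M) (x i) (\<lambda>n. real (min (inventory M i) n)))"
  note p_bounds = purchase_prob_bounds[OF assms(1,2), folded p_def]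
  note q_bounds = purchase_prob_bounds[OF assms(1,3), folded q_def]
  have "exp_rev M nu - 2 * exp_rev M mu =
      (\<Sum>i\<in>products M. revenue M i * (F q i - 2 * F p i))"
    unfolding exp_rev_eq_count_exp[OF assms(1,2)] exp_rev_eq_count_exp[OF assms(1,3)]
    by (simp add: p_def q_def F_def sum_subtractf sum_distrib_left algebra_simps)
  also have "\<dots> \<le> (\<Sum>i\<in>products M. revenue M i * (\<Sum>t\<in>periods M. (q i t - p i t) * D i t))"
  proof (intro sum_mono mult_left_mono)
    fix i assume i: "i \<in> products M"
    have "F q i - F p i \<le> (\<Sum>t\<in>periods M. q i t * D i t)"
      unfolding F_def D_def using p_bounds[OF i] q_bounds[OF i]
      by (intro count_exp_min_diff_le) auto
    moreover have "(\<Sum>t\<in>periods M. p i t * D i t) \<le> F p i"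
      unfolding F_def D_def using p_bounds[OF i] by (intro sum_slack_prob_le) auto
    ultimately show "F q i - 2 * F p i \<le> (\<Sum>t\<in>periods M. (q i t - p i t) * D i t)"
      by (simp add: sum_subtractf left_diff_distrib)
    show "0 \<le> revenue M i" using assms(1) i by (auto simp: valid_model_def)
  qed
  also have "\<dots> = (\<Sum>t\<in>periods M. \<Sum>i\<in>products M. revenue M i * ((q i t - p i t) * D i t))"
    unfolding sum_distrib_left by (rule sum.swap)
  \<comment> \<open>The change of the purchase probability in a period is a sum over customer types,
    and each term contributes the gain of one exchange.\<close>
  also have "\<dots> = (\<Sum>t\<in>periods M. \<Sum>j\<in>types M. exp_rev M (exchange mu j t (A j t)) - exp_rev M mu)"
  proof (rule sum.cong[OF refl])
    fix t assume t: "t \<in> periods M"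
    have diff: "q i t - p i t =
        (\<Sum>j\<in>types M. arrival M j t * (choice M i j (A j t) - assortment_prob M mu i j t))" for i
    proof -
      have "q i t = (\<Sum>j\<in>types M. arrival M j t * choice M i j (A j t))"
        unfolding q_def purchase_prob_alt
        by (intro sum.cong) (auto simp: assortment_prob_return A Asub t)
      then show ?thesis
        by (simp add: p_def purchase_prob_alt sum_subtractf right_diff_distrib)
    qed
    have "(\<Sum>i\<in>products M. revenue M i * ((q i t - p i t) * D i t)) =
        (\<Sum>i\<in>products M. \<Sum>j\<in>types M. revenue M i *
          (arrival M j t * (choice M i j (A j t) - assortment_prob M mu i j t) * D i t))"
      unfolding diff by (simp add: sum_distrib_left sum_distrib_right)
    also have "\<dots> = (\<Sum>j\<in>types M. exp_rev M (exchange mu j t (A j t)) - exp_rev M mu)"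
      by (subst sum.swap)
         (auto intro!: sum.cong simp: exp_rev_exchange[OF assms(1,2) _ t Asub[OF _ t]] D_def p_def)
    finally show "(\<Sum>i\<in>products M. revenue M i * ((q i t - p i t) * D i t)) =
        (\<Sum>j\<in>types M. exp_rev M (exchange mu j t (A j t)) - exp_rev M mu)" .
  qed
  finally show ?thesis .
qed

section \<open>The guarantee at a stopping policy\<close>

text \<open>Makes the division by mT genuine. Without periods nothing is sold, against the positive
  initial revenue; and in a period the arrival probabilities sum to 1, which requires a
  type.\<close>

lemma initial_policy_sizes:
  assumes "valid_model M" "initial_policy M mu"
  shows "0 < n_periods M" "0 < n_types M"
proof -
  show T: "0 < n_periods M"
  proof (rule ccontr)
    assume "\<not> 0 < n_periods M"
    then have "periods M = {}" by (simp add: periods_def)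
    then show False
      using assms exp_rev_eq_count_exp[OF assms(1), of mu] by (simp add: initial_policy_def)
  qed
  then have "1 \<in> periods M" by (simp add: periods_def)
  then have "(\<Sum>j\<in>types M. arrival M j 1) = 1" using assms(1) by (auto simp: valid_model_def)
  then have "types M \<noteq> {}" by auto
  then show "0 < n_types M" by (simp add: types_def)
qed

lemma stops_at_guarantee:
  assumes "valid_model M" "0 < eps" "initial_policy M mu0" "is_policy M mu" "stops_at M eps mu"
  shows "(1 / 2 - eps) * opt_det M \<le> exp_rev M mu"
proof -
  let ?m = "real (n_types M)" and ?T = "real (n_periods M)"
  note pos = initial_policy_sizes[OF assms(1,3)]
  obtain Sstar where best: "best_exchanges M mu Sstar"
    and stop: "\<And>j t. j \<in> types M \<Longrightarrow> t \<in> periods M \<Longrightarrow>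
      \<not> improves M eps mu (exchange mu j t (Sstar j t))"
    using assms(5) by (auto simp: stops_at_def)
  have "opt_det M \<in> exp_rev M ` {mu. is_policy M mu \<and> deterministic M mu}"
    unfolding opt_det_def by (rule Max_in) (rule opt_det_well_defined[OF assms(1)])+
  then obtain nu where nu: "is_policy M nu" "deterministic M nu" "opt_det M = exp_rev M nu"
    by auto
  obtain A where A: "\<And>j t. j \<in> types M \<Longrightarrow> t \<in> periods M \<Longrightarrow> nu j t = return_pmf (A j t)"
    and Asub: "\<And>j t. j \<in> types M \<Longrightarrow> t \<in> periods M \<Longrightarrow> A j t \<subseteq> products M"
    using deterministic_obtain[OF nu(1,2)] by blast
  have "opt_det M - 2 * exp_rev M mu \<le>
      (\<Sum>t\<in>periods M. \<Sum>j\<in>types M. exp_rev M (exchange mu j t (A j t)) - exp_rev M mu)"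
    unfolding nu(3) by (rule sum_exchange_ge[OF assms(1,4) nu(1) A Asub])
  \<comment> \<open>The assortment of the optimal policy does no better than the maximiser, which
    fails the improvement test. The mT equal bounds then cancel the denominator of the
    threshold.\<close>
  also have "\<dots> \<le> (\<Sum>t\<in>periods M. \<Sum>j\<in>types M. eps * (4 / (?m * ?T)) * exp_rev M mu)"
  proof (intro sum_mono)
    fix t j assume tj: "t \<in> periods M" "j \<in> types M"
    have "exp_rev M (exchange mu j t (A j t)) \<le> exp_rev M (exchange mu j t (Sstar j t))"
      using best tj Asub[OF tj(2,1)] by (auto simp: best_exchanges_def is_arg_max_def not_less)
    then show "exp_rev M (exchange mu j t (A j t)) - exp_rev M mu \<le>
        eps * (4 / (?m * ?T)) * exp_rev M mu"
      using stop[OF tj(2,1)] by (simp add: improves_def algebra_simps)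
  qed
  also have "\<dots> = 4 * eps * exp_rev M mu"
    using pos by (simp add: types_def periods_def)
  finally have "opt_det M \<le> (2 + 4 * eps) * exp_rev M mu"
    by (simp add: algebra_simps)
  then have le: "opt_det M / (2 + 4 * eps) \<le> exp_rev M mu"
    using assms(2) by (simp add: divide_le_eq mult.commute)
  have "0 \<le> opt_det M" unfolding nu(3) by (rule exp_rev_nonneg[OF assms(1) nu(1)])
  \<comment> \<open>This is (1/2 - eps) * (2 + 4 * eps) = 1 - 4 * eps^2 \<le> 1.\<close>
  moreover have "1 / 2 - eps \<le> 1 / (2 + 4 * eps)"
    using assms(2) by (simp add: field_simps)
  ultimately have "(1 / 2 - eps) * opt_det M \<le> 1 / (2 + 4 * eps) * opt_det M"
    by (intro mult_right_mono)
  with le show ?thesis by simp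
qed

section \<open>Stopping as the absence of updates\<close>

lemma best_exchanges_exist: "\<exists>Sstar. best_exchanges M mu Sstar"
proof -
  have "\<exists>S. is_arg_max (\<lambda>S. exp_rev M (exchange mu j t S)) (\<lambda>S. S \<subseteq> products M) S" for j t
    using ex_is_arg_min_if_finite[of "Pow (products M)" "\<lambda>S. - exp_rev M (exchange mu j t S)"]
    by (auto simp: is_arg_min_def is_arg_max_def)
  then show ?thesis unfolding best_exchanges_def by metis
qed

text \<open>Maximisers may differ as sets, but the improvement test sees only their value.\<close>

lemma best_exchanges_unique_value:
  assumes "best_exchanges M mu S" "best_exchanges M mu S'" "j \<in> types M" "t \<in> periods M"
  shows "exp_rev M (exchange mu j t (S j t)) = exp_rev M (exchange mu j t (S' j t))"
proof -
  have "is_arg_max (\<lambda>S. exp_rev M (exchange mu j t S)) (\<lambda>S. S \<subseteq> products M) (S j t)"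
    and "is_arg_max (\<lambda>S. exp_rev M (exchange mu j t S)) (\<lambda>S. S \<subseteq> products M) (S' j t)"
    using assms by (auto simp: best_exchanges_def)
  then show ?thesis
    unfolding is_arg_max_def by (meson linorder_neqE)
qed

text \<open>Both \<open>stops_at\<close> and \<open>update\<close> choose maximisers existentially.
  Uniqueness of the maximal value carries a failed test over to all choices; existence of maximisers
  gives the converse.\<close>

lemma stops_at_iff: "stops_at M eps mu \<longleftrightarrow> \<not> (\<exists>mu'. update M eps mu mu')"
proof
  assume "stops_at M eps mu"
  then obtain S where S: "best_exchanges M mu S"
    and stop: "\<And>j t. j \<in> types M \<Longrightarrow> t \<in> periods M \<Longrightarrow> \<not> improves M eps mu (exchange mu j t (S j t))"
    unfolding stops_at_def by blast
  have "\<not> improves M eps mu (exchange mu j t (S' j t))"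
    if "best_exchanges M mu S'" "j \<in> types M" "t \<in> periods M" for S' j t
    using stop[OF that(2,3)] best_exchanges_unique_value[OF S that] by (simp add: improves_def)
  then show "\<not> (\<exists>mu'. update M eps mu mu')"
    unfolding update_def by blast
next
  assume "\<not> (\<exists>mu'. update M eps mu mu')"
  then show "stops_at M eps mu"
    using best_exchanges_exist[of M mu] unfolding stops_at_def update_def by blast
qed

section \<open>The number of updates\<close>

lemma update_is_policy:
  assumes "update M eps mu mu'" "is_policy M mu"
  shows "is_policy M mu'"
proof -
  obtain S j t where S: "best_exchanges M mu S" and jt: "j \<in> types M" "t \<in> periods M"
    and mu': "mu' = exchange mu j t (S j t)"
    using assms(1) unfolding update_def by blast
  have "S j t \<subseteq> products M"
    using S jt by (simp add: best_exchanges_def is_arg_max_def)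
  then show ?thesis
    unfolding mu' by (rule is_policy_exchange[OF assms(2)])
qed

lemma update_improves: "update M eps mu mu' \<Longrightarrow> improves M eps mu mu'"
  unfolding update_def by blast

lemma rtranclp_update_is_policy:
  assumes "(update M eps)\<^sup>*\<^sup>* mu mu'" "is_policy M mu"
  shows "is_policy M mu'"
  using assms by induction (auto dest: update_is_policy)

lemma relpowp_update_growth:
  assumes "(update M eps ^^ k) mu mu'" "0 < eps"
  shows "(1 + eps * (4 / (real (n_types M) * real (n_periods M)))) ^ k * exp_rev M mu \<le> exp_rev M mu'"
  using assms(1)
proof (induction k arbitrary: mu')
  case (Suc k)
  then obtain nu where nu: "(update M eps ^^ k) mu nu" "update M eps nu mu'"
    by auto
  let ?g = "1 + eps * (4 / (real (n_types M) * real (n_periods M)))"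
  have "?g * (?g ^ k * exp_rev M mu) \<le> ?g * exp_rev M nu"
    using Suc.IH[OF nu(1)] assms(2) by (intro mult_left_mono) auto
  also have "\<dots> \<le> exp_rev M mu'"
    using update_improves[OF nu(2)] by (simp add: improves_def)
  finally show ?case by (simp add: mult.assoc)
qed simp

text \<open>Geometric growth by 1 + d below the revenue bound gives k * ln (1 + d) \<le> ln (U / R).
  Since d / ln (1 + d) is unbounded in d, a uniform constant needs the cap
  \<open>eps0\<close>.\<close>

lemma update_count_le:
  assumes "valid_model M" "0 < eps" "eps \<le> eps0" "initial_policy M mu0"
    and run: "(update M eps ^^ k) mu0 mu"
  shows "real k \<le> (1 + 4 * eps0) / 4 * (real (n_types M) * real (n_periods M) / eps *
    ln ((\<Sum>i\<in>products M. revenue M i * real (inventory M i)) / exp_rev M mu0))"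
proof -
  let ?U = "\<Sum>i\<in>products M. revenue M i * real (inventory M i)"
  define mT where "mT = real (n_types M) * real (n_periods M)"
  define d where "d = eps * (4 / mT)"
  \<comment> \<open>From mT \<ge> 1 follows d \<le> 4 * eps0, whatever the size of the
    instance.\<close>
  have mT: "1 \<le> mT"
    using initial_policy_sizes[OF assms(1,4)] mult_mono[of 1 "real (n_types M)" 1 "real (n_periods M)"]
    by (simp add: mT_def)
  have init: "is_policy M mu0" "0 < exp_rev M mu0" using assms(4) by (auto simp: initial_policy_def)
  have d: "0 < d" "d \<le> 4 * eps0"
  proof -
    show "0 < d" using mT assms(2) by (simp add: d_def)
    have "4 * eps \<le> 4 * eps0 * mT"
      using mult_mono[of "4 * eps" "4 * eps0" 1 mT] assms(2,3) mT by simp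
    then show "d \<le> 4 * eps0" using mT by (simp add: d_def divide_le_eq)
  qed
  have "is_policy M mu"
    by (rule rtranclp_update_is_policy[OF relpowp_imp_rtranclp[OF run] init(1)])
  then have "(1 + d) ^ k * exp_rev M mu0 \<le> ?U"
    using relpowp_update_growth[OF run assms(2)] exp_rev_le[OF assms(1), of mu]
    by (simp add: d_def mT_def)
  then have "(1 + d) ^ k \<le> ?U / exp_rev M mu0"
    using init(2) by (simp add: le_divide_eq)
  then have "ln ((1 + d) ^ k) \<le> ln (?U / exp_rev M mu0)"
    by (intro ln_mono) (use d in auto)
  then have k: "real k * ln (1 + d) \<le> ln (?U / exp_rev M mu0)"
    using d by (simp add: ln_realpow)
  have "d / (1 + 4 * eps0) \<le> d / (1 + d)"
    using d by (intro divide_left_mono) auto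
  also have "\<dots> = 1 - 1 / (1 + d)"
    using d by (simp add: field_simps)
  \<comment> \<open>The inequality ln x \<le> x - 1 at x = 1 / (1 + d).\<close>
  also have "\<dots> \<le> ln (1 + d)"
    using ln_le_minus_one[of "1 / (1 + d)"] d by (simp add: ln_div)
  finally have "real k * (d / (1 + 4 * eps0)) \<le> real k * ln (1 + d)"
    by (intro mult_left_mono) auto
  with k have "real k * (d / (1 + 4 * eps0)) \<le> ln (?U / exp_rev M mu0)" by linarith
  then have "real k * d \<le> (1 + 4 * eps0) * ln (?U / exp_rev M mu0)"
    using d by (simp add: divide_le_eq mult.commute)
  then have "real k * d * (mT / (4 * eps)) \<le> (1 + 4 * eps0) * ln (?U / exp_rev M mu0) * (mT / (4 * eps))"
    using mT assms(2) by (intro mult_right_mono) auto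
  moreover have "real k * d * (mT / (4 * eps)) = real k"
    using mT assms(2) by (simp add: d_def)
  ultimately show ?thesis
    unfolding mT_def[symmetric] by (simp add: mult.commute mult.left_commute)
qed

lemma no_infinite_run:
  assumes "valid_model M" "0 < eps" "initial_policy M (f 0)"
  shows "\<not> (\<forall>k. update M eps (f k) (f (Suc k)))"
proof
  assume run: "\<forall>k. update M eps (f k) (f (Suc k))"
  have "(update M eps ^^ k) (f 0) (f k)" for k
    by (induction k) (use run in auto)
  then have "real k \<le> (1 + 4 * eps) / 4 * (real (n_types M) * real (n_periods M) / eps *
    ln ((\<Sum>i\<in>products M. revenue M i * real (inventory M i)) / exp_rev M (f 0)))" for k
    \<comment> \<open>Taking \<open>eps0 = eps\<close> bounds the lengths of all prefixes of the run
      by one number.\<close>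
    using update_count_le[OF assms(1,2) order_refl assms(3)] by blast
  then show False using reals_Archimedean2 not_less by blast
qed

theorem mainTheorem6:
  shows "(\<forall>M eps mu0. valid_model M \<and> 0 < eps \<and> initial_policy M mu0 \<longrightarrow>
      \<comment> \<open>each update improves the revenue by the prescribed factor\<close>
      (\<forall>mu mu'. (update M eps)\<^sup>*\<^sup>* mu0 mu \<and> update M eps mu mu' \<longrightarrow>
         exp_rev M mu' \<ge>
           (1 + eps * (4 / (real (n_types M) * real (n_periods M)))) * exp_rev M mu) \<and>
      \<comment> \<open>revenue upper bound for every policy\<close>
      (\<forall>mu. is_policy M mu \<longrightarrow>
         exp_rev M mu \<le> (\<Sum>i\<in>products M. revenue M i * real (inventory M i))) \<and>
      \<comment> \<open>an iteration either updates or stops, and there is no infinite run\<close>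
      (\<forall>mu. (update M eps)\<^sup>*\<^sup>* mu0 mu \<longrightarrow>
         (stops_at M eps mu \<longleftrightarrow> \<not> (\<exists>mu'. update M eps mu mu'))) \<and>
      \<not> (\<exists>f. f 0 = mu0 \<and> (\<forall>k. update M eps (f k) (f (Suc k)))) \<and>
      \<comment> \<open>guarantee at termination\<close>
      (\<forall>mu. (update M eps)\<^sup>*\<^sup>* mu0 mu \<and> stops_at M eps mu \<longrightarrow>
         exp_rev M mu \<ge> (1 / 2 - eps) * opt_det M)) \<and>
    \<comment> \<open>the number of updates; the constant is uniform over all instances and all bounded \<open>eps\<close>\<close>
    (\<forall>eps0>0. \<exists>C>0. \<forall>M eps mu0 k mu.
      valid_model M \<and> 0 < eps \<and> eps \<le> eps0 \<and> initial_policy M mu0 \<and>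
      (update M eps ^^ k) mu0 mu \<longrightarrow>
        real k \<le> C * (real (n_types M) * real (n_periods M) / eps *
          ln ((\<Sum>i\<in>products M. revenue M i * real (inventory M i)) / exp_rev M mu0)))"
proof (intro conjI allI impI)
  fix M and eps :: real and mu0 mu mu'
  assume "(update M eps)\<^sup>*\<^sup>* mu0 mu \<and> update M eps mu mu'"
  then show "exp_rev M mu' \<ge>
      (1 + eps * (4 / (real (n_types M) * real (n_periods M)))) * exp_rev M mu"
    using update_improves by (auto simp: improves_def)
next
  fix M :: model and eps :: real and mu0 mu
  assume "valid_model M \<and> 0 < eps \<and> initial_policy M mu0" "is_policy M mu"
  then show "exp_rev M mu \<le> (\<Sum>i\<in>products M. revenue M i * real (inventory M i))"
    using exp_rev_le by auto
next
  fix M and eps :: real and mu0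
  assume "valid_model M \<and> 0 < eps \<and> initial_policy M mu0"
  then show "\<not> (\<exists>f. f 0 = mu0 \<and> (\<forall>k. update M eps (f k) (f (Suc k))))"
    using no_infinite_run by blast
next
  fix M and eps :: real and mu0 mu
  assume "valid_model M \<and> 0 < eps \<and> initial_policy M mu0"
    and "(update M eps)\<^sup>*\<^sup>* mu0 mu \<and> stops_at M eps mu"
  then show "exp_rev M mu \<ge> (1 / 2 - eps) * opt_det M"
    using stops_at_guarantee rtranclp_update_is_policy by (meson initial_policy_def)
next
  fix eps0 :: real
  assume "0 < eps0"
  then have "0 < (1 + 4 * eps0) / 4" by simp
  then show "\<exists>C>0. \<forall>M eps mu0 k mu.
      valid_model M \<and> 0 < eps \<and> eps \<le> eps0 \<and> initial_policy M mu0 \<and>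
      (update M eps ^^ k) mu0 mu \<longrightarrow>
        real k \<le> C * (real (n_types M) * real (n_periods M) / eps *
          ln ((\<Sum>i\<in>products M. revenue M i * real (inventory M i)) / exp_rev M mu0))"
    using update_count_le by blast
\<comment> \<open>The conjunct still open is the equivalence of stopping with the absence of an
  update.\<close>
qed (rule stops_at_iff)

end
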